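(* Let $N$ be a positive integer. If there exist vectors $\vec{a},\vec{b}$ with $\{\vec{a},\vec{b}\}\in\mathcal{O}_3(N,2)$, then $N$ is representable as a sum of two squares of integers.
   Context: $\mathcal{O}_3(N,2)$ denotes the collection of sets of two distinct vectors in $\mathbb{Z}^3$ that are orthogonal for the standard inner product and both have Euclidean norm $\sqrt{N}$. In a sum of two squares, $0$ is allowed as a summand. *)

theory Defs
  imports "HOL-Analysis.Analysis"
begin

text \<open>The lattice of integer vectors, seen inside Euclidean three-space so that the
  library's norm and inner product apply.\<close>

definition Z3 :: "(real ^ 3) set" where
  "Z3 = {v. \<forall>i. v $ i \<in> \<int>}"

definition O3_2 :: "nat \<Rightarrow> (real ^ 3) set set" where
  "O3_2 N = {{a, b} | a b. a \<in> Z3 \<and> b \<in> Z3 \<and> a \<noteq> b \<and> a \<bullet> b = 0 \<and>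
     norm a = sqrt (real N) \<and> norm b = sqrt (real N)}"

end

theory Submission
  imports Defs
begin

text \<open>Let \<open>D\<close> be the third coordinate of the cross product of \<open>a\<close> and \<open>b\<close>, and let
  \<open>A = (a\<^sub>1 - b\<^sub>2)\<^sup>2 + (a\<^sub>2 + b\<^sub>1)\<^sup>2\<close>. Lagrange's identity gives
  \<open>D\<^sup>2 = N * (N - a\<^sub>3\<^sup>2 - b\<^sub>3\<^sup>2)\<close>, hence \<open>N * A = (N - D)\<^sup>2\<close>. If \<open>A \<noteq> 0\<close>, this makes \<open>N\<close> a sum
  of two rational squares, and Aubry's descent turns it into a sum of two integer squares;
  if \<open>A = 0\<close>, then \<open>a\<^sub>3 = b\<^sub>3 = 0\<close> and \<open>N = a\<^sub>1\<^sup>2 + a\<^sub>2\<^sup>2\<close>.\<close>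

lemma nearest_multiple:
  fixes x k :: int
  assumes "k > 0"
  obtains u where "2 * \<bar>x - k * u\<bar> \<le> k"
proof
  \<comment> \<open>\<open>u\<close> is the floor of \<open>x / k + 1 / 2\<close>, so
    \<open>x / k\<close> is rounded to a nearest integer.\<close>
  define u where "u = (2 * x + k) div (2 * k)"
  have "(2 * x + k) mod (2 * k) = 2 * (x - k * u) + k"
    unfolding u_def by (simp add: minus_mult_div_eq_mod [symmetric] algebra_simps)
  moreover have "0 \<le> (2 * x + k) mod (2 * k)" "(2 * x + k) mod (2 * k) < 2 * k"
    using assms by simp_all
  ultimately have "- k \<le> 2 * (x - k * u)" "2 * (x - k * u) \<le> k"
    by auto
  then show "2 * \<bar>x - k * u\<bar> \<le> k"
    by (simp add: abs_if)
qed

text \<open>Aubry's descent: the line from the rational point \<open>(x/k, y/k)\<close> of the circle of radius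
  \<open>sqrt n\<close> through a nearest lattice point \<open>(u, v)\<close> meets the circle again in a point with
  smaller denominator \<open>l\<close>.\<close>

lemma sum_two_squares_of_rational:
  fixes n x y k :: int
  assumes "k > 0" and "k\<^sup>2 * n = x\<^sup>2 + y\<^sup>2"
  shows "\<exists>x y :: int. n = x\<^sup>2 + y\<^sup>2"
  using assms
proof (induction "nat k" arbitrary: k x y rule: less_induct)
  case less
  obtain u where u: "2 * \<bar>x - k * u\<bar> \<le> k"
    using nearest_multiple less.prems(1) .
  obtain v where v: "2 * \<bar>y - k * v\<bar> \<le> k"
    using nearest_multiple less.prems(1) .
  \<comment> \<open>\<open>l / k\<close> is the squared distance from \<open>(u, v)\<close> to
    \<open>(x / k, y / k)\<close>; rounding bounds it by 1/2. \<open>m\<close> is the power of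
    \<open>(u, v)\<close> with respect to the circle.\<close>
  define r s m l where "r = x - k * u" and "s = y - k * v" and "m = u\<^sup>2 + v\<^sup>2 - n"
    and "l = k * n - 2 * (x * u + y * v) + k * (u\<^sup>2 + v\<^sup>2)"
  have rs: "r\<^sup>2 + s\<^sup>2 = k * l"
    using less.prems(2) unfolding r_def s_def l_def by algebra
  have "\<bar>2 * r\<bar> \<le> \<bar>k\<bar>" "\<bar>2 * s\<bar> \<le> \<bar>k\<bar>"
    using u v less.prems(1) unfolding r_def [symmetric] s_def [symmetric] by (simp_all add: abs_mult)
  then have "(2 * r)\<^sup>2 \<le> k\<^sup>2" "(2 * s)\<^sup>2 \<le> k\<^sup>2"
    by (simp_all only: abs_le_square_iff)
  then have "2 * (k * l) \<le> k * k"
    using rs by (simp add: power2_eq_square)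
  then have "2 * l \<le> k"
    using less.prems(1) by (simp add: mult.left_commute)
  have "0 \<le> k * l"
    using rs by (metis sum_power2_ge_zero)
  then have "l \<ge> 0"
    using less.prems(1) by (simp add: zero_le_mult_iff)
  show ?case
  proof (cases "l = 0")
    case True
    then have "r = 0" "s = 0"
      using rs by (simp_all add: sum_power2_eq_zero_iff)
    then have "k\<^sup>2 * n = k\<^sup>2 * (u\<^sup>2 + v\<^sup>2)"
      using less.prems(2) by (simp add: r_def s_def power_mult_distrib distrib_left)
    then show ?thesis
      using less.prems(1) by auto
  next
    case False
    have "2 * (u * r + v * s) + m * k + l = 0"
      unfolding r_def s_def m_def l_def by algebra
    \<comment> \<open>On the line \<open>(u, v) + t * (r, s)\<close> the circle equation has the
      root \<open>t = 1 / k\<close>, hence by Vieta also \<open>t = m / l\<close>, which gives the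
      new point.\<close>
    then have "l\<^sup>2 * n = (l * u + m * r)\<^sup>2 + (l * v + m * s)\<^sup>2"
      using rs m_def by algebra
    then show ?thesis
      using less.hyps [of l] False \<open>l \<ge> 0\<close> \<open>2 * l \<le> k\<close> less.prems(1) by simp
  qed
qed

lemma sum_two_squares_of_orthogonal:
  fixes n a1 a2 a3 b1 b2 b3 :: int
  assumes a: "a1\<^sup>2 + a2\<^sup>2 + a3\<^sup>2 = n" and b: "b1\<^sup>2 + b2\<^sup>2 + b3\<^sup>2 = n"
    and ab: "a1 * b1 + a2 * b2 + a3 * b3 = 0"
  shows "\<exists>x y :: int. n = x\<^sup>2 + y\<^sup>2"
proof -
  \<comment> \<open>With \<open>z = a1 + i * a2\<close> and \<open>w = b1 + i * b2\<close>,
    \<open>A\<close> is the squared modulus of \<open>z + i * w\<close>.\<close>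
  define D A where "D = a1 * b2 - a2 * b1" and "A = (a1 - b2)\<^sup>2 + (a2 + b1)\<^sup>2"
  have D: "D\<^sup>2 = n * (n - a3\<^sup>2 - b3\<^sup>2)"
  proof -
    have "a1\<^sup>2 + a2\<^sup>2 = n - a3\<^sup>2" "b1\<^sup>2 + b2\<^sup>2 = n - b3\<^sup>2" "a1 * b1 + a2 * b2 = - (a3 * b3)"
      using a b ab by linarith+
    moreover have "D\<^sup>2 = (a1\<^sup>2 + a2\<^sup>2) * (b1\<^sup>2 + b2\<^sup>2) - (a1 * b1 + a2 * b2)\<^sup>2"
      unfolding D_def by algebra
    ultimately have "D\<^sup>2 = (n - a3\<^sup>2) * (n - b3\<^sup>2) - (- (a3 * b3))\<^sup>2"
      by presburger
    then show ?thesis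
      by algebra
  qed
  have A: "A = 2 * n - a3\<^sup>2 - b3\<^sup>2 - 2 * D"
  proof -
    have "A = a1\<^sup>2 + a2\<^sup>2 + (b1\<^sup>2 + b2\<^sup>2) - 2 * D"
      unfolding A_def D_def by algebra
    then show ?thesis
      using a b by linarith
  qed
  have nA: "n * A = (n - D)\<^sup>2"
    using D A by algebra
  show ?thesis
  proof (cases "A = 0")
    case True
    then have "n = D"
      using nA by simp
    then have "a3\<^sup>2 + b3\<^sup>2 = 0"
      using A True by linarith
    then have "a3 = 0"
      by (simp add: sum_power2_eq_zero_iff)
    then show ?thesis
      using a by auto
  next
    case False
    moreover have "A \<ge> 0"
      by (simp add: A_def)
    \<comment> \<open>Multiply \<open>nA\<close> by \<open>A\<close>, itself a sum of two squares;
      \<open>A\<close> serves as the denominator.\<close>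
    moreover have "A\<^sup>2 * n = ((a1 - b2) * (n - D))\<^sup>2 + ((a2 + b1) * (n - D))\<^sup>2"
      using nA A_def by algebra
    ultimately show ?thesis
      using sum_two_squares_of_rational [of A n] by simp
  qed
qed

lemma Z3_coords:
  assumes "v \<in> Z3"
  obtains x y z :: int where "v $ 1 = of_int x" "v $ 2 = of_int y" "v $ 3 = of_int z"
proof -
  have "v $ 1 \<in> \<int>" "v $ 2 \<in> \<int>" "v $ 3 \<in> \<int>"
    using assms by (simp_all add: Z3_def)
  then show thesis
    using that by (elim Ints_cases)
qed

theorem proposition4p1:
  fixes N :: nat
  assumes "N > 0"
    and "\<exists>a b. {a, b} \<in> O3_2 N"
  shows "\<exists>x y :: int. int N = x ^ 2 + y ^ 2"
proof -
  from assms(2) obtain a b :: "real ^ 3" where "a \<in> Z3" "b \<in> Z3" and ab: "a \<bullet> b = 0"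
    and "norm a = sqrt (real N)" "norm b = sqrt (real N)"
    unfolding O3_2_def by blast
  then have aa: "a \<bullet> a = real N" and bb: "b \<bullet> b = real N"
    by (simp_all add: dot_square_norm)
  obtain a1 a2 a3 :: int where a: "a $ 1 = of_int a1" "a $ 2 = of_int a2" "a $ 3 = of_int a3"
    using Z3_coords \<open>a \<in> Z3\<close> .
  obtain b1 b2 b3 :: int where b: "b $ 1 = of_int b1" "b $ 2 = of_int b2" "b $ 3 = of_int b3"
    using Z3_coords \<open>b \<in> Z3\<close> .
  have "real_of_int (a1\<^sup>2 + a2\<^sup>2 + a3\<^sup>2) = real_of_int (int N)"
    using aa a by (simp add: inner_vec_def sum_3 power2_eq_square)
  moreover have "real_of_int (b1\<^sup>2 + b2\<^sup>2 + b3\<^sup>2) = real_of_int (int N)"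
    using bb b by (simp add: inner_vec_def sum_3 power2_eq_square)
  moreover have "real_of_int (a1 * b1 + a2 * b2 + a3 * b3) = real_of_int 0"
    using ab a b by (simp add: inner_vec_def sum_3)
  ultimately show ?thesis
    using sum_two_squares_of_orthogonal by (metis of_int_eq_iff)
qed

end
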